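(* Let $G$ be a finite simple connected graph of order $n$ with minimum degree $\delta$, and let $k$ and $k'$ be positive integers. (1) If $k'\ge k+1$ and $\delta\ge k'+1$, then $\gamma_{(k,k',1)}(G)\le n-\delta+k'-1$. (2) If $k\ge k'$ and $\delta\ge k+2$, then $\gamma_{(k,k',1)}(G)\le n-\delta+k$. Moreover, the bounds in (1) and (2) are sharp: for all positive integers $k,k'$ with $k'\ge k+1$ (respectively $k\ge k'$) there is a graph $G$ satisfying the hypotheses of (1) (respectively (2)) for which equality holds.
   Context: Let $G$ be a finite simple connected graph with vertex set $V=V(G)$; its order is $n=|V(G)|$. For nonnegative integers $k,k',k''$, a set $S\subseteq V$ is a $(k,k',k'')$-dominating set in $G$ if every vertex in $S$ has at least $k$ neighbors in $S$, and every vertex in $V\setminus S$ has at least $k'$ neighbors in $S$ and at least $k''$ neighbors in $V\setminus S$. The $(k,k',k'')$-domination number $\gamma_{(k,k',k'')}(G)$ is the minimum cardinality of a $(k,k',k'')$-dominating set in $G$ (if $\delta(G)\ge k$, such a set exists, since $S=V(G)$ is one). *)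

theory Defs
  imports "Graph_Theory.Digraph_Component"
begin

(* Finite simple graphs are the library's locale graph: finite digraphs without loops and
   parallel arcs whose adjacency relation is symmetric, so each undirected edge is
   a pair of opposite arcs. *)

definition neighbors :: "('a, 'b) pre_digraph \<Rightarrow> 'a \<Rightarrow> 'a set" where
  "neighbors G v = {w \<in> verts G. v \<rightarrow>\<^bsub>G\<^esub> w}"

(* In a symmetric digraph without parallel arcs the out-degree of a vertex is its degree.
   Only meaningful if G is finite and has a vertex. *)
definition min_degree :: "('a, 'b) pre_digraph \<Rightarrow> nat" where
  "min_degree G = Min (out_degree G ` verts G)"

definition dominating_set ::
    "nat \<Rightarrow> nat \<Rightarrow> nat \<Rightarrow> ('a, 'b) pre_digraph \<Rightarrow> 'a set \<Rightarrow> bool" where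
  "dominating_set k k' k'' G S \<longleftrightarrow>
     S \<subseteq> verts G \<and>
     (\<forall>v\<in>S. k \<le> card (neighbors G v \<inter> S)) \<and>
     (\<forall>v\<in>verts G - S. k' \<le> card (neighbors G v \<inter> S) \<and>
        k'' \<le> card (neighbors G v \<inter> (verts G - S)))"

(* Unspecified if no dominating set exists; if k is at most the minimum degree,
   the whole vertex set is one. *)
definition domination_number :: "nat \<Rightarrow> nat \<Rightarrow> nat \<Rightarrow> ('a, 'b) pre_digraph \<Rightarrow> nat" where
  "domination_number k k' k'' G = Min (card ` {S. dominating_set k k' k'' G S})"

end

theory Submission
  imports Defs "Graph_Theory.Kuratowski"
begin

text \<open>
  Both upper bounds come from one construction. Take the complement of \<open>S\<close> to be a star: a vertex
  \<open>v\<close> together with \<open>d \<ge> 1\<close> of its neighbours. No vertex of the star is isolated in it, which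
  settles the third parameter. All other requirements follow by counting: a vertex of the star
  loses at most \<open>d\<close> of its at least \<open>\<delta>\<close> neighbours to the star (it is not adjacent to itself), and
  a vertex of \<open>S\<close> loses at most \<open>d + 1\<close>. Hence \<open>S\<close> is \<open>(k, k', 1)\<close>-dominating as soon as
  \<open>k' + d \<le> \<delta>\<close> and \<open>k + d + 1 \<le> \<delta>\<close>. The largest admissible \<open>d\<close> is \<open>\<delta> - k'\<close> if \<open>k < k'\<close>
  and \<open>\<delta> - k - 1\<close> if \<open>k' \<le> k\<close>, and \<open>card S = n - d - 1\<close> gives the two bounds
  (lemma \<open>star_complement_bound\<close>).

  Complete graphs attain both bounds, since \<open>n - \<delta> = 1\<close> turns them into \<open>k'\<close> and \<open>k + 1\<close>. No
  dominating set \<open>S\<close> is smaller: if \<open>S\<close> is not the whole vertex set, a vertex outside \<open>S\<close> needs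
  \<open>k'\<close> neighbours in \<open>S\<close>, and a vertex in \<open>S\<close> needs \<open>k\<close> others in \<open>S\<close>.
\<close>

lemma (in fin_digraph) finite_dominating_sets: "finite {S. dominating_set k k' k'' G S}"
  by (rule finite_subset[of _ "Pow (verts G)"]) (auto simp: dominating_set_def)

lemma (in fin_digraph) domination_number_le:
  assumes "dominating_set k k' k'' G S"
  shows "domination_number k k' k'' G \<le> card S"
  using assms finite_dominating_sets by (auto simp: domination_number_def)

lemma (in fin_digraph) domination_number_ge:
  assumes "dominating_set k k' k'' G S\<^sub>0"
    and "\<And>S. dominating_set k k' k'' G S \<Longrightarrow> m \<le> card S"
  shows "m \<le> domination_number k k' k'' G"
proof -
  have "card ` {S. dominating_set k k' k'' G S} \<noteq> {}"
    using assms(1) by blast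
  then show ?thesis
    using assms(2) finite_dominating_sets by (auto simp: domination_number_def)
qed

lemma (in fin_digraph) finite_neighbors [simp]: "finite (neighbors G v)"
  by (simp add: neighbors_def)

text \<open>
  Mapping an arc to its head is injective on the arcs leaving a fixed vertex because there are no
  parallel arcs.
\<close>
lemma (in digraph) card_neighbors: "card (neighbors G v) = out_degree G v"
proof -
  have "neighbors G v = head G ` out_arcs G v"
    by (auto simp: neighbors_def arcs_ends_conv)
  moreover have "inj_on (head G) (out_arcs G v)"
    by (rule inj_onI) (auto intro: no_multi_arcs simp: arc_to_ends_def)
  ultimately show ?thesis
    by (simp add: out_degree_def card_image)
qed

lemma (in digraph) min_degree_le_card_neighbors:
  assumes "v \<in> verts G"
  shows "min_degree G \<le> card (neighbors G v)"
  using assms by (simp add: card_neighbors min_degree_def)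

lemma (in fin_digraph) card_neighbors_le_inter:
  assumes "A \<subseteq> verts G"
  shows "card (neighbors G v) \<le> card (neighbors G v \<inter> (verts G - A)) + card (neighbors G v \<inter> A)"
proof -
  have "neighbors G v = (neighbors G v \<inter> (verts G - A)) \<union> (neighbors G v \<inter> A)"
    by (auto simp: neighbors_def)
  then show ?thesis
    by (metis card_Un_le)
qed

section \<open>Upper bound: the complement of a star\<close>

text \<open>
  The counting argument works for any set \<open>A\<close> without isolated vertices; stars are merely sets of
  this kind that exist in every small size.
\<close>
lemma (in digraph) complement_dominating_set:
  assumes "A \<subseteq> verts G" "card A = d + 1"
    and deg: "k + d + 1 \<le> min_degree G" "k' + d \<le> min_degree G"
    and adj: "\<And>x. x \<in> A \<Longrightarrow> neighbors G x \<inter> A \<noteq> {}"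
  shows "dominating_set k k' 1 G (verts G - A)"
proof -
  have finA: "finite A"
    using assms(1) finite_verts by (rule finite_subset)
  have "k \<le> card (neighbors G x \<inter> (verts G - A))" if "x \<in> verts G - A" for x
  proof -
    have "card (neighbors G x \<inter> A) \<le> d + 1"
      using card_mono[OF finA, of "neighbors G x \<inter> A"] assms(2) by simp
    then show ?thesis
      using that deg(1) min_degree_le_card_neighbors[of x] card_neighbors_le_inter[OF assms(1), of x]
      by simp
  qed
  moreover have "k' \<le> card (neighbors G x \<inter> (verts G - A))" if "x \<in> A" for x
  proof -
    have "neighbors G x \<inter> A \<subseteq> A - {x}"
      by (auto simp: neighbors_def dest: adj_not_same)
    then have "card (neighbors G x \<inter> A) \<le> card (A - {x})"
      using finA by (simp add: card_mono)
    then have "card (neighbors G x \<inter> A) \<le> d"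
      using that assms(2) finA by simp
    moreover have "x \<in> verts G"
      using that assms(1) by blast
    ultimately show ?thesis
      using deg(2) min_degree_le_card_neighbors[of x] card_neighbors_le_inter[OF assms(1), of x]
      by simp
  qed
  moreover have "1 \<le> card (neighbors G x \<inter> A)" if "x \<in> A" for x
    using adj[OF that] finA by (simp add: Suc_le_eq card_gt_0_iff)
  moreover have "verts G - (verts G - A) = A"
    using assms(1) by blast
  ultimately show ?thesis
    by (simp add: dominating_set_def)
qed

lemma (in graph) star_complement_bound:
  assumes "verts G \<noteq> {}" "1 \<le> d"
    and deg: "k + d + 1 \<le> min_degree G" "k' + d \<le> min_degree G"
  shows "domination_number k k' 1 G + d + 1 \<le> card (verts G)"
proof -
  obtain v where v: "v \<in> verts G"
    using assms(1) by blast
  have "d \<le> card (neighbors G v)"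
    using min_degree_le_card_neighbors[OF v] deg(2) by simp
  then obtain L where L: "L \<subseteq> neighbors G v" "card L = d"
    by (meson obtain_subset_with_card_n)
  have "finite L"
    using L(1) by (rule finite_subset) simp
  moreover have "v \<notin> L"
    using L(1) by (auto simp: neighbors_def dest: adj_not_same)
  ultimately have cardA: "card (insert v L) = d + 1"
    using L(2) by simp
  have subA: "insert v L \<subseteq> verts G"
    using v L(1) by (auto simp: neighbors_def)
  have "neighbors G x \<inter> insert v L \<noteq> {}" if "x \<in> insert v L" for x
  proof (cases "x = v")
    case True
    have "L \<noteq> {}"
      using L(2) assms(2) by auto
    then show ?thesis
      using L(1) True by blast
  next
    case False
    then have "v \<rightarrow> x"
      using that L(1) by (auto simp: neighbors_def)
    then have "v \<in> neighbors G x"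
      using v arcs_ends_symmetric[OF sym_arcs] by (simp add: neighbors_def)
    then show ?thesis
      by blast
  qed
  with subA cardA deg have "dominating_set k k' 1 G (verts G - insert v L)"
    by (intro complement_dominating_set)
  then have "domination_number k k' 1 G \<le> card (verts G - insert v L)"
    by (rule domination_number_le)
  also have "\<dots> = card (verts G) - (d + 1)"
    using cardA by (subst card_Diff_subset[OF finite_subset[OF subA finite_verts] subA]) simp
  finally show ?thesis
    using card_mono[OF finite_verts subA] cardA by simp
qed

section \<open>Sharpness: complete graphs\<close>

lemma complete_digraph_exists: "\<exists>G :: (nat, nat \<times> nat) pre_digraph. complete_digraph n G"
proof
  show "complete_digraph n
    (with_proj \<lparr> pverts = {..<n}, parcs = {(u, v). (u, v) \<in> {..<n} \<times> {..<n} \<and> u \<noteq> v} \<rparr>)"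
    by (simp add: complete_digraph_pair_def)
qed

lemma neighbors_complete_digraph:
  assumes "complete_digraph n G" "v \<in> verts G"
  shows "neighbors G v = verts G - {v}"
  using assms by (auto simp: complete_digraph_def neighbors_def)

lemma connected_complete_digraph:
  assumes "complete_digraph n G" "0 < n"
  shows "connected G"
proof -
  have "(u, v) \<in> rtrancl_on (verts G) ((arcs_ends G)\<^sup>s)" if "u \<in> verts G" "v \<in> verts G" for u v
  proof (cases "u = v")
    case False
    then have "(u, v) \<in> (arcs_ends G)\<^sup>s"
      using assms(1) that by (simp add: complete_digraph_def symcl_def)
    then show ?thesis
      using that by (blast intro: rtrancl_on_into_rtrancl_on rtrancl_on_refl)
  qed (use that in simp)
  moreover have "verts G \<noteq> {}"
    using assms by (auto simp: complete_digraph_def)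
  ultimately show ?thesis
    by (simp add: connected_conv)
qed

lemma min_degree_complete_digraph:
  assumes "complete_digraph n G" "0 < n"
  shows "min_degree G = n - 1"
proof -
  interpret graph G
    using assms(1) by (simp add: complete_digraph_def)
  have n: "card (verts G) = n" "verts G \<noteq> {}"
    using assms by (auto simp: complete_digraph_def)
  have "out_degree G v = n - 1" if "v \<in> verts G" for v
    using that n(1) card_neighbors[of v] neighbors_complete_digraph[OF assms(1) that] by simp
  then have "out_degree G ` verts G = {n - 1}"
    using n(2) by (auto simp: image_iff)
  then show ?thesis
    by (simp add: min_degree_def)
qed

text \<open>
  A dominating set is nonempty, because its complement would otherwise consist of vertices with no
  neighbour in it, so it contains a vertex and \<open>k\<close> of its neighbours. The bound \<open>k'\<close> comes from a
  vertex outside; the whole vertex set has none, hence the hypothesis \<open>k' \<le> n\<close>.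
\<close>
lemma card_dominating_set_complete_digraph:
  assumes G: "complete_digraph n G" and "1 \<le> k'" "k' \<le> n"
    and S: "dominating_set k k' k'' G S"
  shows "max (k + 1) k' \<le> card S"
proof -
  interpret graph G
    using G by (simp add: complete_digraph_def)
  have n: "card (verts G) = n" "verts G \<noteq> {}"
    using assms by (auto simp: complete_digraph_def)
  have sub: "S \<subseteq> verts G"
    using S by (simp add: dominating_set_def)
  then have finS: "finite S"
    using finite_verts by (rule finite_subset)
  have outside: "k' \<le> card S" if "v \<in> verts G - S" for v
  proof -
    have "k' \<le> card (neighbors G v \<inter> S)"
      using S that by (simp add: dominating_set_def)
    also have "\<dots> \<le> card S"
      using finS by (simp add: card_mono)
    finally show ?thesis .
  qed
  have k': "k' \<le> card S"
  proof (cases "S = verts G")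
    case True
    then show ?thesis
      using n(1) assms(3) by simp
  next
    case False
    then show ?thesis
      using sub outside by blast
  qed
  then have "S \<noteq> {}"
    using assms(2) by auto
  then obtain u where u: "u \<in> S"
    by blast
  have "k \<le> card (neighbors G u \<inter> S)"
    using S u by (simp add: dominating_set_def)
  also have "neighbors G u \<inter> S = S - {u}"
    using neighbors_complete_digraph[OF G] u sub by blast
  also have "card \<dots> = card S - 1"
    using u finS by simp
  finally have "k + 1 \<le> card S"
    using u finS card_gt_0_iff[of S] by auto
  with k' show ?thesis
    by simp
qed

text \<open>
  The upper bound is the star construction with \<open>d = n - 1 - max (k + 1) k'\<close>; the order \<open>n\<close> must
  leave room for a star with at least one leaf.
\<close>
lemma domination_number_complete_digraph:
  assumes G: "complete_digraph n G" and "1 \<le> k'" and n: "max (k + 1) k' + 2 \<le> n"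
  shows "domination_number k k' 1 G = max (k + 1) k'"
proof (rule antisym)
  interpret graph G
    using G by (simp add: complete_digraph_def)
  have card: "card (verts G) = n" "verts G \<noteq> {}"
    using assms by (auto simp: complete_digraph_def)
  have deg: "min_degree G = n - 1"
    using min_degree_complete_digraph[OF G] n by simp
  define d where "d = n - 1 - max (k + 1) k'"
  have "domination_number k k' 1 G + d + 1 \<le> card (verts G)"
    using card(2) by (rule star_complement_bound) (use n deg d_def in auto)
  then show "domination_number k k' 1 G \<le> max (k + 1) k'"
    using card(1) n d_def by simp
  show "max (k + 1) k' \<le> domination_number k k' 1 G"
  proof (rule domination_number_ge)
    have "neighbors G v \<inter> verts G = verts G - {v}" if "v \<in> verts G" for v
      using neighbors_complete_digraph[OF G that] by blast
    then show "dominating_set k k' 1 G (verts G)"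
      using card(1) n by (auto simp: dominating_set_def)
  next
    fix S
    assume "dominating_set k k' 1 G S"
    then show "max (k + 1) k' \<le> card S"
      using card_dominating_set_complete_digraph[OF G] assms(2) n by simp
  qed
qed

section \<open>The bounds and their sharpness\<close>

theorem theorem3p1:
  fixes k k' :: nat
  assumes "k \<ge> 1" and "k' \<ge> 1"
  shows "(k' \<ge> k + 1 \<longrightarrow>
            (\<forall>G :: ('a, 'b) pre_digraph.
               graph G \<and> connected G \<and> min_degree G \<ge> k' + 1 \<longrightarrow>
               int (domination_number k k' 1 G)
                 \<le> int (card (verts G)) - int (min_degree G) + int k' - 1)) \<and>
         (k \<ge> k' \<longrightarrow>
            (\<forall>G :: ('a, 'b) pre_digraph.
               graph G \<and> connected G \<and> min_degree G \<ge> k + 2 \<longrightarrow>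
               int (domination_number k k' 1 G)
                 \<le> int (card (verts G)) - int (min_degree G) + int k)) \<and>
         (k' \<ge> k + 1 \<longrightarrow>
            (\<exists>G :: (nat, nat \<times> nat) pre_digraph.
               graph G \<and> connected G \<and> min_degree G \<ge> k' + 1 \<and>
               int (domination_number k k' 1 G)
                 = int (card (verts G)) - int (min_degree G) + int k' - 1)) \<and>
         (k \<ge> k' \<longrightarrow>
            (\<exists>G :: (nat, nat \<times> nat) pre_digraph.
               graph G \<and> connected G \<and> min_degree G \<ge> k + 2 \<and>
               int (domination_number k k' 1 G)
                 = int (card (verts G)) - int (min_degree G) + int k))"
proof (intro conjI impI allI; (elim conjE)?)
  fix G :: "('a, 'b) pre_digraph"
  assume "k' \<ge> k + 1" and G: "graph G" "connected G" and deg: "min_degree G \<ge> k' + 1"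
  interpret graph G by (fact G(1))
  have "domination_number k k' 1 G + (min_degree G - k') + 1 \<le> card (verts G)"
    using \<open>k' \<ge> k + 1\<close> deg G(2) by (intro star_complement_bound) (auto simp: connected_conv)
  with deg show "int (domination_number k k' 1 G)
      \<le> int (card (verts G)) - int (min_degree G) + int k' - 1"
    by linarith
next
  fix G :: "('a, 'b) pre_digraph"
  assume "k \<ge> k'" and G: "graph G" "connected G" and deg: "min_degree G \<ge> k + 2"
  interpret graph G by (fact G(1))
  have "domination_number k k' 1 G + (min_degree G - k - 1) + 1 \<le> card (verts G)"
    using \<open>k \<ge> k'\<close> deg G(2) by (intro star_complement_bound) (auto simp: connected_conv)
  with deg show "int (domination_number k k' 1 G)
      \<le> int (card (verts G)) - int (min_degree G) + int k"
    by linarith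
next
  assume "k' \<ge> k + 1"
  obtain G :: "(nat, nat \<times> nat) pre_digraph" where G: "complete_digraph (k' + 2) G"
    using complete_digraph_exists by blast
  moreover have "domination_number k k' 1 G = k'"
    using domination_number_complete_digraph[OF G, of k' k] \<open>k' \<ge> k + 1\<close> by simp
  ultimately show "\<exists>G :: (nat, nat \<times> nat) pre_digraph.
      graph G \<and> connected G \<and> min_degree G \<ge> k' + 1 \<and>
      int (domination_number k k' 1 G) = int (card (verts G)) - int (min_degree G) + int k' - 1"
    using connected_complete_digraph[OF G] min_degree_complete_digraph[OF G]
    by (intro exI[of _ G]) (simp add: complete_digraph_def)
next
  assume "k \<ge> k'"
  obtain G :: "(nat, nat \<times> nat) pre_digraph" where G: "complete_digraph (k + 3) G"
    using complete_digraph_exists by blast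
  moreover have "domination_number k k' 1 G = k + 1"
    using domination_number_complete_digraph[OF G, of k' k] \<open>k \<ge> k'\<close> assms(2) by simp
  ultimately show "\<exists>G :: (nat, nat \<times> nat) pre_digraph.
      graph G \<and> connected G \<and> min_degree G \<ge> k + 2 \<and>
      int (domination_number k k' 1 G) = int (card (verts G)) - int (min_degree G) + int k"
    using connected_complete_digraph[OF G] min_degree_complete_digraph[OF G]
    by (intro exI[of _ G]) (simp add: complete_digraph_def)
qed

end
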